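(* In the mobile telephone model with tag length $b=0$ and any stability factor $\tau\ge 1$, the BlindMatch gossip algorithm solves the gossip problem in $O\left((1/\alpha)\,k\,\Delta^2\log^2 N\right)$ rounds, where $k$ is the number of tokens, $N\ge n$ is the upper bound on the network size $n$ given to the nodes, and $\alpha$ and $\Delta$ are the vertex expansion and maximum degree of the dynamic graph describing the network topology.
   Context: Mobile telephone model. Time proceeds in synchronous rounds $1,2,\dots$, and all nodes start in round 1. The topology is a dynamic graph $G_1,G_2,\dots$ fixed before the execution begins, where each $G_r=(V,E_r)$ is a connected undirected graph on the same node set $V$, $|V|=n>1$. Stability factor $\tau\ge1$: at least $\tau$ rounds pass between any two changes of the topology ($\tau=1$: it may change arbitrarily every round; $\tau=\infty$: it never changes). At the beginning of round $r$ each node selects a tag of $b$ bits to advertise ($b=0$: no tag), then learns its neighbor set in $G_r$ and the tags of its neighbors. Each node may then send a connection proposal to at most one neighbor. A node that sends a proposal cannot receive one; a node that does not send a proposal and receives at least one proposal accepts one chosen uniformly at random among those received. A proposer and acceptor are then connected for the round and may exchange at most $O(1)$ tokens and $O(\mathrm{polylog}(N))$ additional bits. Graph parameters. For a graph $G=(V,E)$ and $S\subseteq V$ nonempty, $\partial S$ is the set of nodes in $V\setminus S$ with a neighbor in $S$, and $\alpha(G)=\min_{S\subset V,\,0<|S|\le n/2}|\partial S|/|S|$. For a dynamic graph, $\alpha=\min_i\alpha(G_i)$ and $\Delta$ is the largest maximum degree of any $G_i$. Gossip problem. Each node knows an upper bound $N\ge n$ and has a unique ID in $[N]=\{1,\dots,N\}$.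 There are $k$ tokens, $1\le k\le n$ ($k$ is not known to the nodes), each initially held by exactly one node; tokens are black boxes, labelled by distinct elements of $[N]$ (which orders them), that can only be passed through connections. $T_u(r)$ is the set of tokens known by $u$ at the beginning of round $r$. An algorithm solves gossip in $f$ rounds if, with probability at least $1-1/n$, all nodes know all $k$ tokens by round $f$. $O(\cdot)$ is asymptotic with universal constants. Transfer$(\varepsilon)$ subroutine. Run by two connected nodes $u,v$ with token sets $T_u,T_v$ (using fresh private randomness, and $O(\log^2 N\cdot\log(\log N/\varepsilon))$ control bits); if $T_u\ne T_v$, then with probability at least $1-\varepsilon$ the smallest token in $(T_u\cup T_v)\setminus(T_u\cap T_v)$ is transferred by the node that knows it to the node that does not. In all cases nodes only gain tokens that the other node knows. BlindMatch. In each round each node independently flips a fair coin to be a sender or a receiver. A sender chooses a neighbor uniformly at random among its current neighbors and sends it a connection proposal. A receiver waits for proposals. If two nodes connect they run Transfer$(\varepsilon)$, where $\varepsilon=N^{-c}$ for a sufficiently large constant $c$. *)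

theory Defs
  imports "HOL-Probability.Probability" "HOL-Probability.Product_PMF" "HOL-Library.Extended_Nat"
begin

section \<open>Dynamic graphs\<close>

text \<open>
  Nodes are identified with their unique IDs, hence are natural numbers. An undirected simple
  graph on \<open>V\<close> is a symmetric irreflexive relation on \<open>V\<close>. A dynamic graph is a function
  \<open>G\<close> from rounds to graphs, of which only the values at rounds \<open>1, 2, \<dots>\<close> matter.
\<close>

type_synonym graph = "(nat \<times> nat) set"

definition connected_graph :: "nat set \<Rightarrow> graph \<Rightarrow> bool" where
  "connected_graph V E \<longleftrightarrow>
     E \<subseteq> V \<times> V \<and> sym E \<and> irrefl E \<and> (\<forall>u\<in>V. \<forall>v\<in>V. (u, v) \<in> E\<^sup>*)"

definition dynamic_graph :: "nat set \<Rightarrow> (nat \<Rightarrow> graph) \<Rightarrow> bool" where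
  "dynamic_graph V G \<longleftrightarrow> finite V \<and> (\<forall>r\<ge>1. connected_graph V (G r))"

definition topology_change :: "(nat \<Rightarrow> graph) \<Rightarrow> nat \<Rightarrow> bool" where
  "topology_change G r \<longleftrightarrow> r \<ge> 1 \<and> G (Suc r) \<noteq> G r"

text \<open>
  For \<open>\<tau> = \<infinity>\<close> the first clause alone would still admit one change.
\<close>
definition stability_factor :: "(nat \<Rightarrow> graph) \<Rightarrow> enat \<Rightarrow> bool" where
  "stability_factor G \<tau> \<longleftrightarrow>
     (\<forall>r r'. topology_change G r \<and> topology_change G r' \<and> r < r' \<longrightarrow> \<tau> \<le> enat (r' - r)) \<and>
     (\<tau> = \<infinity> \<longrightarrow> (\<forall>r. \<not> topology_change G r))"

definition neighbours :: "graph \<Rightarrow> nat \<Rightarrow> nat set" where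
  "neighbours E u = {v. (u, v) \<in> E}"

definition boundary :: "nat set \<Rightarrow> graph \<Rightarrow> nat set \<Rightarrow> nat set" where
  "boundary V E S = {v \<in> V - S. \<exists>u\<in>S. (u, v) \<in> E}"

definition vertex_expansion :: "nat set \<Rightarrow> graph \<Rightarrow> real" where
  "vertex_expansion V E =
     Min ((\<lambda>S. real (card (boundary V E S)) / real (card S)) `
          {S. S \<subset> V \<and> 0 < card S \<and> real (card S) \<le> real (card V) / 2})"

text \<open>
  The next two extrema range over all rounds, but over only finitely many values, since there are
  finitely many graphs on \<open>V\<close>.
\<close>

definition expansion :: "nat set \<Rightarrow> (nat \<Rightarrow> graph) \<Rightarrow> real" where
  "expansion V G = Min ((\<lambda>r. vertex_expansion V (G r)) ` {1..})"

definition max_degree :: "nat set \<Rightarrow> (nat \<Rightarrow> graph) \<Rightarrow> nat" where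
  "max_degree V G = Max ((\<lambda>(r, u). card (neighbours (G r) u)) ` ({1..} \<times> V))"


section \<open>The mobile telephone model with tag length 0\<close>

text \<open>
  The local state of a node has type \<open>'s\<close>. As there are no tags, a node decides on its proposal from
  its ID, its state and its current neighbour set: \<open>Some v\<close> is a proposal to \<open>v\<close>, and \<open>None\<close> means
  that no proposal is sent. A connected pair updates its two states by a random interaction whose
  arguments and results list the proposer first.
\<close>

type_synonym 's proposal_rule = "nat \<Rightarrow> 's \<Rightarrow> nat set \<Rightarrow> nat option pmf"
type_synonym 's interaction = "nat \<Rightarrow> nat \<Rightarrow> 's \<Rightarrow> 's \<Rightarrow> ('s \<times> 's) pmf"

definition received :: "graph \<Rightarrow> (nat \<Rightarrow> nat option) \<Rightarrow> nat \<Rightarrow> nat set" where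
  "received E prop v = {u \<in> neighbours E v. prop u = Some v}"

definition accept :: "graph \<Rightarrow> (nat \<Rightarrow> nat option) \<Rightarrow> nat \<Rightarrow> nat option pmf" where
  "accept E prop v =
     (if prop v = None \<and> received E prop v \<noteq> {}
      then map_pmf Some (pmf_of_set (received E prop v))
      else return_pmf None)"

text \<open>
  Each connection is indexed by its accepting node: \<open>acc v = Some u\<close> says that \<open>v\<close> accepted the
  proposal of \<open>u\<close>, and \<open>out v\<close> then holds the new states of \<open>u\<close> and \<open>v\<close>. If \<open>acc v = None\<close>, then
  \<open>out v\<close> is a dummy value. The products \<open>Pi_pmf\<close> make the random choices of different nodes, and of
  different connections, independent.
\<close>

definition interact ::
  "'s interaction \<Rightarrow> (nat \<Rightarrow> 's) \<Rightarrow> (nat \<Rightarrow> nat option) \<Rightarrow> nat \<Rightarrow> ('s \<times> 's) pmf" where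
  "interact I st acc v =
     (case acc v of None \<Rightarrow> return_pmf undefined | Some u \<Rightarrow> I u v (st u) (st v))"

definition new_state ::
  "(nat \<Rightarrow> 's) \<Rightarrow> (nat \<Rightarrow> nat option) \<Rightarrow> (nat \<Rightarrow> nat option) \<Rightarrow> (nat \<Rightarrow> 's \<times> 's) \<Rightarrow> nat \<Rightarrow> 's" where
  "new_state st prop acc out w =
     (case prop w of
        Some v \<Rightarrow> if acc v = Some w then fst (out v) else st w
      | None \<Rightarrow> if acc w = None then st w else snd (out w))"

definition mtm_round ::
  "nat set \<Rightarrow> graph \<Rightarrow> 's proposal_rule \<Rightarrow> 's interaction \<Rightarrow> (nat \<Rightarrow> 's) \<Rightarrow> (nat \<Rightarrow> 's) pmf" where
  "mtm_round V E P I st =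
     bind_pmf (Pi_pmf V None (\<lambda>u. P u (st u) (neighbours E u))) (\<lambda>prop.
     bind_pmf (Pi_pmf V None (accept E prop)) (\<lambda>acc.
     bind_pmf (Pi_pmf V undefined (interact I st acc)) (\<lambda>out.
     return_pmf (new_state st prop acc out))))"

text \<open>
  \<open>mtm_run V G P I st r\<close> is the distribution of the configuration after rounds \<open>1, \<dots>, r\<close>, that is,
  at the beginning of round \<open>r + 1\<close>. The dynamic graph does not depend on the execution.
\<close>

primrec mtm_run ::
  "nat set \<Rightarrow> (nat \<Rightarrow> graph) \<Rightarrow> 's proposal_rule \<Rightarrow> 's interaction \<Rightarrow> (nat \<Rightarrow> 's) \<Rightarrow> nat
     \<Rightarrow> (nat \<Rightarrow> 's) pmf" where
  "mtm_run V G P I st 0 = return_pmf st"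
| "mtm_run V G P I st (Suc r) =
     bind_pmf (mtm_run V G P I st r) (mtm_round V (G (Suc r)) P I)"


section \<open>Gossip\<close>

text \<open>
  \<open>V \<subseteq> {1..N}\<close> says that the IDs lie in \<open>[N]\<close>; it entails \<open>card V \<le> N\<close>. A node may hold several
  tokens initially; disjointness says that each token has exactly one initial holder.
\<close>

definition gossip_instance :: "nat set \<Rightarrow> nat \<Rightarrow> nat \<Rightarrow> (nat \<Rightarrow> nat set) \<Rightarrow> bool" where
  "gossip_instance V N k T \<longleftrightarrow>
     V \<subseteq> {1..N} \<and> disjoint_family_on T V \<and> (\<Union>u\<in>V. T u) \<subseteq> {1..N} \<and>
     card (\<Union>u\<in>V. T u) = k \<and> 1 \<le> k \<and> k \<le> card V"

text \<open>
  \<open>run f\<close> is the distribution of the nodes' token sets after \<open>f\<close> rounds, started from \<open>T\<close>.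
\<close>

definition solves_gossip_in ::
  "nat set \<Rightarrow> (nat \<Rightarrow> nat set) \<Rightarrow> (nat \<Rightarrow> (nat \<Rightarrow> nat set) pmf) \<Rightarrow> nat \<Rightarrow> bool" where
  "solves_gossip_in V T run f \<longleftrightarrow>
     measure_pmf.prob (run f) {T'. \<forall>u\<in>V. (\<Union>v\<in>V. T v) \<subseteq> T' u} \<ge> 1 - 1 / real (card V)"


section \<open>BlindMatch\<close>

text \<open>
  An implementation of \<open>Transfer(\<epsilon>)\<close>, known only through its specification, as a random interaction
  on token sets. \<open>B\<close> bounds the number of tokens exchanged over one connection.
\<close>

definition is_transfer :: "nat \<Rightarrow> nat \<Rightarrow> real \<Rightarrow> nat set interaction \<Rightarrow> bool" where
  "is_transfer N B \<epsilon> transfer \<longleftrightarrow>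
     (\<forall>u\<in>{1..N}. \<forall>v\<in>{1..N}. \<forall>X Y. u \<noteq> v \<and> X \<subseteq> {1..N} \<and> Y \<subseteq> {1..N} \<longrightarrow>
        (\<forall>(X', Y') \<in> set_pmf (transfer u v X Y).
           X \<subseteq> X' \<and> X' \<subseteq> X \<union> Y \<and> Y \<subseteq> Y' \<and> Y' \<subseteq> X \<union> Y \<and>
           card (X' - X) + card (Y' - Y) \<le> B) \<and>
        (X \<noteq> Y \<longrightarrow>
           measure_pmf.prob (transfer u v X Y)
             {(X', Y'). Min ((X \<union> Y) - (X \<inter> Y)) \<in> X' \<inter> Y'} \<ge> 1 - \<epsilon>))"

definition blind_match_proposal :: "nat set proposal_rule" where
  "blind_match_proposal u T nbrs =
     bind_pmf (bernoulli_pmf (1/2)) (\<lambda>sender.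
       if sender then map_pmf Some (pmf_of_set nbrs) else return_pmf None)"

definition blind_match ::
  "nat set \<Rightarrow> (nat \<Rightarrow> graph) \<Rightarrow> nat set interaction \<Rightarrow> (nat \<Rightarrow> nat set) \<Rightarrow> nat
     \<Rightarrow> (nat \<Rightarrow> nat set) pmf" where
  "blind_match V G transfer = mtm_run V G blind_match_proposal transfer"

end

theory Submission imports Defs begin

text \<open>
  Let \<open>s\<^sub>t\<close> be the number of nodes knowing token \<open>t\<close> and \<open>\<phi>\<^sub>t = (n - s\<^sub>t) / s\<^sub>t\<close>. The connections of a round
  form a matching, so \<open>s\<^sub>t\<close> at most doubles, which makes the drop of \<open>\<phi>\<^sub>t\<close> at least \<open>n / (2 s\<^sub>t\<^sup>2)\<close> times
  the number of nodes that newly learn \<open>t\<close>. If \<open>t\<close> is the smallest token not yet known to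
  everyone, then a connection between a node with \<open>t\<close> and one without passes \<open>t\<close> unless Transfer fails.
  A given edge is used in a given direction with probability at least \<open>1 / (4 \<Delta>\<^sup>2)\<close>, and at least
  \<open>\<alpha> min s\<^sub>t (n - s\<^sub>t)\<close> nodes have a neighbour on the other side, so \<open>\<phi>\<^sub>t\<close> shrinks in expectation by a factor
  \<open>1 - \<alpha> / (16 \<Delta>\<^sup>2)\<close>. In the potential \<open>\<Sum>\<^sub>t n\<^sup>2\<^sup>j \<phi>\<^sub>t\<close>, where \<open>j\<close> tokens are larger than \<open>t\<close>, that token has at
  least half of the total, so the potential shrinks in expectation by \<open>1 - \<alpha> / (32 \<Delta>\<^sup>2)\<close> in every
  round. It starts below \<open>n\<^sup>2\<^sup>k\<^sup>+\<^sup>1\<close> and is at least \<open>1 / n\<close> until gossip is complete, so Markov's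
  inequality gives the bound, even with \<open>log N\<close> in place of \<open>log\<^sup>2 N\<close>.
\<close>

section \<open>How one round changes the set of nodes knowing a token\<close>

definition informed :: "nat set \<Rightarrow> (nat \<Rightarrow> nat set) \<Rightarrow> nat \<Rightarrow> nat set" where
  "informed V st t = {w \<in> V. t \<in> st w}"

text \<open>Collects what is certain about every outcome in the support of a round, so that the
  counting arguments need no probability.\<close>

locale round_outcome =
  fixes V :: "nat set" and E :: graph and st :: "nat \<Rightarrow> nat set"
    and sent acc :: "nat \<Rightarrow> nat option" and out :: "nat \<Rightarrow> nat set \<times> nat set"
  assumes finite_V: "finite V"
    and acc_SomeD: "acc w = Some u \<Longrightarrow>
      u \<in> V \<and> w \<in> V \<and> (u, w) \<in> E \<and> sent u = Some w \<and> sent w = None"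
    and out_bounds: "acc w = Some u \<Longrightarrow>
      st u \<subseteq> fst (out w) \<and> fst (out w) \<subseteq> st u \<union> st w \<and>
      st w \<subseteq> snd (out w) \<and> snd (out w) \<subseteq> st u \<union> st w"
begin

abbreviation st' :: "nat \<Rightarrow> nat set" where
  "st' \<equiv> new_state st sent acc out"

text \<open>Meaningful only at a connected node: a rejected sender is still mapped to its target,
  and \<open>the None\<close> can occur.\<close>

definition partner :: "nat \<Rightarrow> nat" where
  "partner w = (case sent w of Some v \<Rightarrow> v | None \<Rightarrow> the (acc w))"

definition passing :: "nat \<Rightarrow> nat set" where
  "passing t = {w \<in> V. \<exists>u. acc w = Some u \<and> (t \<in> st u) \<noteq> (t \<in> st w) \<and>
     t \<in> fst (out w) \<and> t \<in> snd (out w)}"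

lemma new_state_mono: "st w \<subseteq> st' w"
  using out_bounds by (auto simp: new_state_def split: option.splits)

text \<open>Besides the source of a new token, this records which end accepted; the injectivity of
  \<open>partner\<close> on learners depends on it.\<close>

lemma new_state_gain:
  assumes "t \<in> st' w" "t \<notin> st w"
  shows "partner w \<in> V \<and> t \<in> st (partner w) \<and>
    (acc w = Some (partner w) \<and> sent w = None \<or> acc (partner w) = Some w \<and> sent w = Some (partner w))"
proof (cases "sent w")
  case None
  then obtain u where u: "acc w = Some u" "t \<in> snd (out w)"
    using assms by (auto simp: new_state_def split: if_splits)
  then show ?thesis using None out_bounds[OF u(1)] acc_SomeD[OF u(1)] assms(2)
    by (auto simp: partner_def)
next
  case (Some v)
  then have v: "acc v = Some w" "t \<in> fst (out v)"
    using assms by (auto simp: new_state_def split: if_splits)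
  then show ?thesis using Some out_bounds[OF v(1)] acc_SomeD[OF v(1)] assms(2)
    by (auto simp: partner_def)
qed

lemma new_state_subset:
  assumes "\<And>u. u \<in> V \<Longrightarrow> st u \<subseteq> A" "w \<in> V"
  shows "st' w \<subseteq> A"
  using new_state_gain assms by blast

lemma informed_mono: "informed V st t \<subseteq> informed V st' t"
  using new_state_mono by (auto simp: informed_def)

text \<open>Connections form a matching, so mapping each new learner to its partner is an injection
  into the nodes that already knew \<open>t\<close>.\<close>

lemma card_informed_double: "card (informed V st' t) \<le> 2 * card (informed V st t)"
proof -
  let ?S = "informed V st t" and ?S' = "informed V st' t"
  have fin: "finite ?S" "finite ?S'" using finite_V by (auto simp: informed_def)
  have gain: "w \<in> ?S' - ?S \<Longrightarrow> t \<in> st' w \<and> t \<notin> st w" for w by (auto simp: informed_def)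
  have "inj_on partner (?S' - ?S)"
  proof (rule inj_onI)
    fix x y assume x: "x \<in> ?S' - ?S" and y: "y \<in> ?S' - ?S" and eq: "partner x = partner y"
    \<comment> \<open>The common partner either sent, hence to one node only, or accepted, hence
      from one node only; \<open>acc_SomeD\<close> excludes doing both.\<close>
    show "x = y"
      using new_state_gain[of t x] new_state_gain[of t y] gain[OF x] gain[OF y] eq
      by (metis acc_SomeD option.distinct(1) option.inject)
  qed
  moreover have "partner ` (?S' - ?S) \<subseteq> ?S"
    using new_state_gain gain by (fastforce simp: informed_def)
  ultimately have "card (?S' - ?S) \<le> card ?S"
    using card_inj_on_le fin by blast
  moreover have "card ?S' = card ?S + card (?S' - ?S)"
    using card_Diff_subset[OF fin(1) informed_mono] card_mono[OF fin(2) informed_mono] by simp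
  ultimately show ?thesis by simp
qed

text \<open>Counting a passing connection by its accepting endpoint is what makes the expected gain
  additive over nodes, whichever endpoint learns the token.\<close>
lemma card_passing: "card (informed V st t) + card (passing t) \<le> card (informed V st' t)"
proof -
  let ?S = "informed V st t" and ?S' = "informed V st' t"
  \<comment> \<open>Maps an acceptor to the end of its connection that lacked \<open>t\<close>. The
    acceptor can be recovered: it is the learner itself if the learner sent nothing, and otherwise
    the target of its proposal.\<close>
  define learner where "learner w = (if t \<in> st w then the (acc w) else w)" for w
  have fin: "finite ?S" "finite ?S'" using finite_V by (auto simp: informed_def)
  have l: "learner w \<in> V \<and> t \<notin> st (learner w) \<and> t \<in> st' (learner w) \<and>
      (learner w = w \<and> sent w = None \<or> sent (learner w) = Some w)" if w: "w \<in> passing t" for w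
  proof -
    from w obtain u where u: "acc w = Some u" "(t \<in> st u) \<noteq> (t \<in> st w)"
      "t \<in> fst (out w)" "t \<in> snd (out w)"
      by (auto simp: passing_def)
    show ?thesis using u acc_SomeD[OF u(1)] by (auto simp: learner_def new_state_def)
  qed
  have "inj_on learner (passing t)"
    using l by (intro inj_onI) (metis option.distinct(1) option.inject)
  moreover have "learner ` passing t \<subseteq> ?S' - ?S"
    using l by (auto simp: informed_def)
  ultimately have "card (passing t) \<le> card (?S' - ?S)"
    using card_inj_on_le fin by blast
  then show ?thesis
    using card_Diff_subset[OF fin(1) informed_mono] card_mono[OF fin(2) informed_mono[of t]]
    by simp
qed

end

section \<open>The potential and its weights\<close>

text \<open>Natural subtraction, together with the value 0 when nobody knows \<open>t\<close>, makes
  this nonnegative for every configuration; lower bounds on it require a holder of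
  \<open>t\<close>.\<close>

definition deficit :: "nat set \<Rightarrow> (nat \<Rightarrow> nat set) \<Rightarrow> nat \<Rightarrow> real" where
  "deficit V st t = real (card V - card (informed V st t)) / real (card (informed V st t))"

definition weight :: "nat set \<Rightarrow> nat set \<Rightarrow> nat \<Rightarrow> real" where
  "weight V A t = (real (card V))\<^sup>2 ^ card {t' \<in> A. t < t'}"

definition potential :: "nat set \<Rightarrow> nat set \<Rightarrow> (nat \<Rightarrow> nat set) \<Rightarrow> real" where
  "potential V A st = (\<Sum>t\<in>A. weight V A t * deficit V st t)"

text \<open>The exact drop is n (s' - s) / (s s'), and s' \<le> 2 s bounds the denominator by
  \<open>2 * s\<^sup>2\<close>, which depends only on the state before the round.\<close>

lemma deficit_decrease:
  fixes n s s' x :: real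
  assumes "0 < s" "s + x \<le> s'" "s' \<le> n" "s' \<le> 2 * s" "0 \<le> x"
  shows "(n - s') / s' + n / (2 * s\<^sup>2) * x \<le> (n - s) / s"
proof -
  have pos: "0 < s'" "0 < n" using assms by linarith+
  have "n / (2 * s\<^sup>2) * x \<le> n / (s * s') * (s' - s)"
  proof (rule mult_mono)
    have "s * s' \<le> 2 * s\<^sup>2" using assms by (simp add: power2_eq_square)
    then show "n / (2 * s\<^sup>2) \<le> n / (s * s')"
      using pos assms by (intro divide_left_mono) auto
  qed (use assms pos in auto)
  also have "\<dots> = (n - s) / s - (n - s') / s'"
    using assms pos by (simp add: field_simps)
  finally show ?thesis by simp
qed

text \<open>The exponents run through 0, ..., |A| - 1 once each, so this is a geometric series.
  Inserting a new minimum adds the exponent |A| and leaves the others unchanged.\<close>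

lemma sum_geometric_rank:
  fixes A :: "nat set" and W :: real
  assumes "finite A"
  shows "(W - 1) * (\<Sum>x\<in>A. W ^ card {y \<in> A. x < y}) = W ^ card A - 1"
  using assms
proof (induction A rule: finite_linorder_min_induct)
  case empty
  then show ?case by simp
next
  case (insert b A)
  have "{y \<in> insert b A. b < y} = A" using insert by auto
  moreover have "(\<Sum>x\<in>A. W ^ card {y \<in> insert b A. x < y}) = (\<Sum>x\<in>A. W ^ card {y \<in> A. x < y})"
    using insert by (intro sum.cong refl arg_cong[where f = "\<lambda>B. W ^ card B"]) auto
  moreover have "b \<notin> A" using insert by auto
  ultimately show ?case using insert by (simp add: algebra_simps)
qed

section \<open>Probabilities of events in staged and product choices\<close>

text \<open>Chains the stages of a round: each stage contributes a factor that is bounded only when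
  the earlier stages went well.\<close>

lemma prob_bind_pmf_ge:
  assumes "measure_pmf.prob M Y \<ge> a" "0 \<le> a" "0 \<le> b"
    and "\<And>x. x \<in> set_pmf M \<Longrightarrow> x \<in> Y \<Longrightarrow> measure_pmf.prob (f x) X \<ge> b"
  shows "measure_pmf.prob (bind_pmf M f) X \<ge> a * b"
proof -
  have "ennreal (a * b) \<le> ennreal (b * measure_pmf.prob M Y)"
    using mult_left_mono[OF assms(1) assms(3)] by (intro ennreal_leI) (simp add: mult.commute)
  also have "\<dots> = ennreal b * emeasure M Y"
    using assms by (simp add: measure_pmf.emeasure_eq_measure ennreal_mult)
  also have "\<dots> = (\<integral>\<^sup>+x. ennreal b * indicator Y x \<partial>M)"
    by (simp add: nn_integral_cmult_indicator)
  also have "\<dots> \<le> (\<integral>\<^sup>+x. emeasure (f x) X \<partial>M)"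
    using assms(4)
    by (intro nn_integral_mono_AE AE_pmfI)
       (auto simp: indicator_def measure_pmf.emeasure_eq_measure ennreal_leI)
  also have "\<dots> = ennreal (measure_pmf.prob (bind_pmf M f) X)"
    by (simp flip: measure_pmf.emeasure_eq_measure)
  finally show ?thesis by simp
qed

lemma prob_Pi_pmf_component:
  assumes "finite A" "x \<in> A"
  shows "measure_pmf.prob (Pi_pmf A d p) {f. f x \<in> X} = measure_pmf.prob (p x) X"
proof -
  have "measure_pmf.prob (map_pmf (\<lambda>f. f x) (Pi_pmf A d p)) X = measure_pmf.prob (p x) X"
    using assms by (simp add: Pi_pmf_component)
  then show ?thesis by (simp add: vimage_def)
qed

lemma prob_Pi_pmf_two_components:
  assumes "finite A" "x \<in> A" "y \<in> A" "x \<noteq> y"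
  shows "measure_pmf.prob (Pi_pmf A d p) {f. f x \<in> X \<and> f y \<in> Y} =
    measure_pmf.prob (p x) X * measure_pmf.prob (p y) Y"
proof -
  let ?B = "(\<lambda>_. UNIV)(x := X, y := Y)"
  have "{f. f x \<in> X \<and> f y \<in> Y} = Pi A ?B"
    using assms by (auto simp: Pi_def)
  moreover have "(\<Prod>z\<in>A. measure_pmf.prob (p z) (?B z)) =
      (\<Prod>z\<in>{x, y}. measure_pmf.prob (p z) (?B z))"
    using assms by (intro prod.mono_neutral_right) auto
  ultimately show ?thesis using assms by (simp add: measure_Pi_pmf_Pi)
qed

text \<open>Keeps the intermediate choices, because which connection passed a token cannot be read
  off the new configuration.\<close>

definition round_choices :: "nat set \<Rightarrow> graph \<Rightarrow> 's proposal_rule \<Rightarrow> 's interaction \<Rightarrow> (nat \<Rightarrow> 's) \<Rightarrow>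
    ((nat \<Rightarrow> nat option) \<times> (nat \<Rightarrow> nat option) \<times> (nat \<Rightarrow> 's \<times> 's)) pmf" where
  "round_choices V E P I st =
     bind_pmf (Pi_pmf V None (\<lambda>u. P u (st u) (neighbours E u))) (\<lambda>sent.
     bind_pmf (Pi_pmf V None (accept E sent)) (\<lambda>acc.
     map_pmf (\<lambda>out. (sent, acc, out)) (Pi_pmf V undefined (interact I st acc))))"

lemma mtm_round_conv_choices:
  "mtm_round V E P I st = map_pmf (\<lambda>(sent, acc, out). new_state st sent acc out) (round_choices V E P I st)"
  by (simp add: mtm_round_def round_choices_def map_bind_pmf map_pmf_comp flip: map_pmf_def)

lemma pmf_blind_match_proposal_None:
  "pmf (blind_match_proposal u X B) None = 1/2"
proof -
  have "pmf (map_pmf Some (pmf_of_set B)) None = 0"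
    by (simp add: pmf_eq_0_set_pmf)
  then show ?thesis
    by (simp add: blind_match_proposal_def pmf_bind integral_measure_pmf_real[where A = UNIV] UNIV_bool)
qed

lemma pmf_blind_match_proposal_Some:
  assumes "finite B" "v \<in> B"
  shows "pmf (blind_match_proposal u X B) (Some v) = 1 / (2 * real (card B))"
proof -
  have "B \<noteq> {}" using assms by auto
  then have "pmf (map_pmf Some (pmf_of_set B)) (Some v) = 1 / real (card B)"
    using assms by (subst pmf_map_inj') auto
  then show ?thesis
    by (simp add: blind_match_proposal_def pmf_bind integral_measure_pmf_real[where A = UNIV] UNIV_bool)
qed

lemma is_transferD:
  assumes "is_transfer N B \<epsilon> I" "u \<in> {1..N}" "v \<in> {1..N}" "u \<noteq> v" "X \<subseteq> {1..N}" "Y \<subseteq> {1..N}"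
  shows "p \<in> set_pmf (I u v X Y) \<Longrightarrow>
      X \<subseteq> fst p \<and> fst p \<subseteq> X \<union> Y \<and> Y \<subseteq> snd p \<and> snd p \<subseteq> X \<union> Y"
    and "X \<noteq> Y \<Longrightarrow> measure_pmf.prob (I u v X Y)
      {(X', Y'). Min ((X \<union> Y) - (X \<inter> Y)) \<in> X' \<inter> Y'} \<ge> 1 - \<epsilon>"
proof -
  note spec = bspec[OF bspec[OF assms(1)[unfolded is_transfer_def] assms(2)] assms(3),
      THEN spec, THEN spec, THEN mp, of X Y, OF conjI[OF assms(4) conjI[OF assms(5,6)]]]
  show "p \<in> set_pmf (I u v X Y) \<Longrightarrow>
      X \<subseteq> fst p \<and> fst p \<subseteq> X \<union> Y \<and> Y \<subseteq> snd p \<and> snd p \<subseteq> X \<union> Y"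
    using bspec[OF conjunct1[OF spec], of p] by (simp add: case_prod_unfold)
  show "X \<noteq> Y \<Longrightarrow> measure_pmf.prob (I u v X Y)
      {(X', Y'). Min ((X \<union> Y) - (X \<inter> Y)) \<in> X' \<inter> Y'} \<ge> 1 - \<epsilon>"
    using conjunct2[OF spec] by (rule mp)
qed

section \<open>Expected progress of BlindMatch in one round\<close>

text \<open>\<open>A\<close> is the set of all tokens. \<alpha> and \<Delta> are mere bounds for
  this one graph, so the same values can serve every round. \<open>st_subset\<close> and
  \<open>held\<close> are the invariants that carry over from round to round.\<close>

locale blind_match_round =
  fixes V :: "nat set" and E :: graph and N B :: nat and \<epsilon> :: real
    and I :: "nat set interaction" and A :: "nat set" and st :: "nat \<Rightarrow> nat set"
    and \<alpha> :: real and \<Delta> :: nat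
  assumes V: "V \<subseteq> {1..N}" "1 < card V" and A: "A \<subseteq> {1..N}"
    and E: "E \<subseteq> V \<times> V" "sym E" "irrefl E"
    and nbrs_nonempty: "u \<in> V \<Longrightarrow> neighbours E u \<noteq> {}"
    and degree: "u \<in> V \<Longrightarrow> card (neighbours E u) \<le> \<Delta>"
    and transfer: "is_transfer N B \<epsilon> I" and eps: "\<epsilon> \<le> 1 / 2"
    and alpha: "0 \<le> \<alpha>" "\<And>S. S \<subset> V \<Longrightarrow> 0 < card S \<Longrightarrow> real (card S) \<le> real (card V) / 2 \<Longrightarrow>
      \<alpha> * real (card S) \<le> real (card (boundary V E S))"
    and st_subset: "u \<in> V \<Longrightarrow> st u \<subseteq> A"
    and held: "t \<in> A \<Longrightarrow> \<exists>u\<in>V. t \<in> st u"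
begin

abbreviation choices where "choices \<equiv> round_choices V E blind_match_proposal I st"

lemma finite_V: "finite V" and finite_A: "finite A"
  using V A finite_subset by blast+

lemma neighbours_props: "finite (neighbours E u)" "v \<in> neighbours E u \<Longrightarrow> u \<in> V \<and> v \<in> V \<and> u \<noteq> v"
proof -
  show "finite (neighbours E u)"
    using E(1) by (intro finite_subset[OF _ finite_V]) (auto simp: neighbours_def)
  show "v \<in> neighbours E u \<Longrightarrow> u \<in> V \<and> v \<in> V \<and> u \<noteq> v"
    using E by (auto simp: neighbours_def irrefl_def)
qed

lemma received_subset: "received E sent v \<subseteq> neighbours E v"
  by (auto simp: received_def)

lemma round_outcome_choices:
  assumes "(sent, acc, out) \<in> set_pmf choices"
  shows "round_outcome V E st sent acc out"
proof -
  have acc: "acc \<in> set_pmf (Pi_pmf V None (accept E sent))"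
    and out: "out \<in> set_pmf (Pi_pmf V undefined (interact I st acc))"
    using assms by (auto simp: round_choices_def)
  have accD: "u \<in> V \<and> w \<in> V \<and> (u, w) \<in> E \<and> sent u = Some w \<and> sent w = None"
    if "acc w = Some u" for u w
  proof -
    \<comment> \<open>Outside \<open>V\<close> the product takes the default value
      \<open>None\<close>, so an accepting node lies in \<open>V\<close>.\<close>
    have "w \<in> V"
      using acc that finite_V by (cases "w \<in> V") (auto simp: set_Pi_pmf PiE_dflt_def)
    then have "Some u \<in> set_pmf (accept E sent w)"
      using acc that finite_V by (force simp: set_Pi_pmf PiE_dflt_def)
    then have "sent w = None" "u \<in> received E sent w"
      using finite_subset[OF received_subset neighbours_props(1)]
      by (auto simp: accept_def split: if_splits)
    then show ?thesis using E by (auto simp: received_def neighbours_def sym_def)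
  qed
  have "st u \<subseteq> fst (out w) \<and> fst (out w) \<subseteq> st u \<union> st w \<and>
      st w \<subseteq> snd (out w) \<and> snd (out w) \<subseteq> st u \<union> st w" if a: "acc w = Some u" for u w
  proof -
    have u: "u \<in> V" "w \<in> V" "u \<noteq> w" using accD[OF a] E by (auto simp: irrefl_def)
    then have "out w \<in> set_pmf (I u w (st u) (st w))"
      using out a finite_V by (force simp: set_Pi_pmf PiE_dflt_def interact_def)
    moreover have "u \<in> {1..N}" "w \<in> {1..N}" "st u \<subseteq> {1..N}" "st w \<subseteq> {1..N}"
      using u V A st_subset by blast+
    ultimately show ?thesis
      by (intro is_transferD(1)[OF transfer _ _ u(3)])
  qed
  with accD finite_V show ?thesis by unfold_locales auto
qed

lemma degree_pos: "u \<in> V \<Longrightarrow> 0 < card (neighbours E u)"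
  using nbrs_nonempty neighbours_props(1) by (simp add: card_gt_0_iff)

text \<open>Three factors: 1 / (4 \<Delta>) for \<open>u\<close> sending to \<open>w\<close> while
  \<open>w\<close> is a receiver, 1 / \<Delta> for \<open>w\<close> choosing \<open>u\<close> among
  at most \<Delta> proposals, and 1 / 2 for Transfer. Smaller tokens are known to both ends, so
  \<open>t\<close> is the minimum of the symmetric difference and is the token Transfer aims
  at.\<close>

lemma prob_connection:
  assumes t: "t \<in> A" "\<And>t'. t' \<in> A \<Longrightarrow> t' < t \<Longrightarrow> \<forall>u\<in>V. t' \<in> st u"
    and w: "(u, w) \<in> E" "(t \<in> st u) \<noteq> (t \<in> st w)"
  shows "measure_pmf.prob choices
      {(sent, acc, out). acc w = Some u \<and> t \<in> fst (out w) \<and> t \<in> snd (out w)} \<ge> 1 / (8 * (real \<Delta>)\<^sup>2)"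
    (is "measure_pmf.prob _ ?X \<ge> _")
proof -
  have uw: "u \<in> V" "w \<in> V" "u \<noteq> w" "w \<in> neighbours E u" "u \<in> neighbours E w"
    using w E by (auto simp: neighbours_def sym_def)
  have 1: "measure_pmf.prob (Pi_pmf V None (\<lambda>u. blind_match_proposal u (st u) (neighbours E u)))
      {sent. sent u \<in> {Some w} \<and> sent w \<in> {None}} \<ge> 1 / (4 * real \<Delta>)"
  proof -
    have "1 / (4 * real \<Delta>) \<le> 1 / (4 * real (card (neighbours E u)))"
      using degree[OF uw(1)] degree_pos[OF uw(1)] by (intro divide_left_mono) auto
    then show ?thesis
      using uw finite_V neighbours_props
      by (subst prob_Pi_pmf_two_components)
         (auto simp: measure_pmf_single pmf_blind_match_proposal_None pmf_blind_match_proposal_Some)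
  qed
  have 2: "measure_pmf.prob (Pi_pmf V None (accept E sent)) {acc. acc w \<in> {Some u}} \<ge> 1 / real \<Delta>"
    if s: "sent u = Some w" "sent w = None" for sent
  proof -
    have u: "u \<in> received E sent w" using uw s by (auto simp: received_def)
    have fin: "finite (received E sent w)"
      using finite_subset[OF received_subset neighbours_props(1)] .
    have "card (received E sent w) \<le> \<Delta>"
      using card_mono[OF neighbours_props(1) received_subset] degree[OF uw(2)] order_trans by blast
    moreover have "0 < card (received E sent w)" using u fin by (auto simp: card_gt_0_iff)
    ultimately have "1 / real \<Delta> \<le> 1 / real (card (received E sent w))"
      by (intro divide_left_mono) auto
    moreover have "pmf (accept E sent w) (Some u) = 1 / real (card (received E sent w))"
      using u fin s by (auto simp: accept_def pmf_map_inj' pmf_of_set)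
    ultimately show ?thesis
      using uw finite_V by (subst prob_Pi_pmf_component) (auto simp: measure_pmf_single)
  qed
  have 3: "measure_pmf.prob (Pi_pmf V undefined (interact I st acc))
      {out. t \<in> fst (out w) \<and> t \<in> snd (out w)} \<ge> 1 / 2" if a: "acc w = Some u" for acc
  proof -
    have sub: "st u \<subseteq> {1..N}" "st w \<subseteq> {1..N}" "u \<in> {1..N}" "w \<in> {1..N}"
      using uw V A st_subset by blast+
    have "Min ((st u \<union> st w) - (st u \<inter> st w)) = t"
    proof (rule Min_eqI)
      show "finite (st u \<union> st w - st u \<inter> st w)"
        using sub finite_subset by blast
      show "t \<le> y" if "y \<in> st u \<union> st w - st u \<inter> st w" for y
      proof (rule ccontr)
        assume "\<not> t \<le> y"
        moreover have "y \<in> A" using that st_subset[OF uw(1)] st_subset[OF uw(2)] by blast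
        ultimately have "\<forall>u\<in>V. y \<in> st u" using t(2) by simp
        then show False using that uw by blast
      qed
    qed (use w in auto)
    moreover have "st u \<noteq> st w" using w(2) by auto
    ultimately have "measure_pmf.prob (I u w (st u) (st w)) {(X', Y'). t \<in> X' \<inter> Y'} \<ge> 1 - \<epsilon>"
      using is_transferD(2)[OF transfer sub(3,4) uw(3) sub(1,2)] by simp
    then have "measure_pmf.prob (interact I st acc w) {(X', Y'). t \<in> X' \<inter> Y'} \<ge> 1 / 2"
      using eps a by (simp add: interact_def)
    moreover have "{out. t \<in> fst (out w) \<and> t \<in> snd (out w)} =
        {out. out w \<in> {(X', Y'). t \<in> X' \<inter> Y'}}"
      by (simp only: case_prod_unfold mem_Collect_eq Int_iff)
    ultimately show ?thesis
      by (simp only: prob_Pi_pmf_component[OF finite_V uw(2)])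
  qed
  have 23: "measure_pmf.prob (bind_pmf (Pi_pmf V None (accept E sent)) (\<lambda>acc.
      map_pmf (\<lambda>out. (sent, acc, out)) (Pi_pmf V undefined (interact I st acc)))) ?X
    \<ge> 1 / real \<Delta> * (1 / 2)" if s: "sent u = Some w" "sent w = None" for sent
  proof (rule prob_bind_pmf_ge[OF 2[OF s]])
    fix acc assume "acc \<in> {acc :: nat \<Rightarrow> nat option. acc w \<in> {Some u}}"
    then show "1 / 2 \<le> measure_pmf.prob (map_pmf (\<lambda>out. (sent, acc, out))
        (Pi_pmf V undefined (interact I st acc))) ?X"
      using 3[of acc] by (simp add: vimage_def)
  qed simp_all
  have "measure_pmf.prob choices ?X \<ge> 1 / (4 * real \<Delta>) * (1 / real \<Delta> * (1 / 2))"
    unfolding round_choices_def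
    by (rule prob_bind_pmf_ge[OF 1]) (use 23 in simp_all)
  then show ?thesis by (simp add: power2_eq_square)
qed


abbreviation passes where "passes acc out t \<equiv> round_outcome.passing V st acc out t"

lemma card_informed_bounds:
  assumes "t \<in> A"
  shows "0 < card (informed V st t)" "card (informed V st t) \<le> card V"
proof -
  have "informed V st t \<noteq> {}" using held[OF assms] by (auto simp: informed_def)
  moreover have "finite (informed V st t)" using finite_V by (simp add: informed_def)
  ultimately show "0 < card (informed V st t)" by (simp add: card_gt_0_iff)
  show "card (informed V st t) \<le> card V"
    using finite_V by (intro card_mono) (auto simp: informed_def)
qed

text \<open>Holds for every possible outcome and every token, so no deficit ever increases; chance
  only enters through the number of passing connections.\<close>

lemma deficit_step:
  assumes "t \<in> A" "(sent, acc, out) \<in> set_pmf choices"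
  shows "deficit V (new_state st sent acc out) t +
      real (card V) / (2 * (real (card (informed V st t)))\<^sup>2) * real (card (passes acc out t))
    \<le> deficit V st t"
proof -
  interpret round_outcome V E st sent acc out
    using round_outcome_choices[OF assms(2)] .
  have le: "card (informed V (new_state st sent acc out) t) \<le> card V"
    using finite_V by (intro card_mono) (auto simp: informed_def)
  let ?s = "card (informed V st t)" and ?s' = "card (informed V (new_state st sent acc out) t)"
  have "(real (card V) - real ?s') / real ?s' +
      real (card V) / (2 * (real ?s)\<^sup>2) * real (card (passes acc out t))
    \<le> (real (card V) - real ?s) / real ?s"
  proof (rule deficit_decrease)
    show "0 < real ?s" using card_informed_bounds[OF assms(1)] by simp
    show "real ?s + real (card (passes acc out t)) \<le> real ?s'"
      using card_passing[of t] by linarith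
    show "real ?s' \<le> 2 * real ?s" using card_informed_double[of t] by linarith
  qed (use le in simp_all)
  then show ?thesis
    using card_informed_bounds(2)[OF assms(1)] le by (simp only: deficit_def of_nat_diff)
qed

text \<open>By linearity it suffices to sum, over possible acceptors, the probability of accepting a
  passing connection. Every node with a neighbour on the other side of the cut contributes 1 / (8
  \<Delta>^2), and expansion bounds the number of such nodes from below.\<close>

lemma expectation_card_passing:
  assumes t: "t \<in> A" "\<And>t'. t' \<in> A \<Longrightarrow> t' < t \<Longrightarrow> \<forall>u\<in>V. t' \<in> st u"
    and inc: "card (informed V st t) < card V"
  shows "measure_pmf.expectation choices (\<lambda>(sent, acc, out). real (card (passes acc out t))) \<ge>
    \<alpha> * min (real (card (informed V st t))) (real (card V - card (informed V st t))) / (8 * (real \<Delta>)\<^sup>2)"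
proof -
  let ?S = "informed V st t"
  \<comment> \<open>Takes nodes from both sides of the cut, so it contains the boundaries of
    \<open>?S\<close> and of \<open>V - ?S\<close>; expansion is applied to whichever has at most n
    / 2 nodes.\<close>
  define C where "C = {w \<in> V. \<exists>u. (u, w) \<in> E \<and> (t \<in> st u) \<noteq> (t \<in> st w)}"
  define X where "X w = {(sent :: nat \<Rightarrow> nat option, acc, out). w \<in> passes acc out t}" for w
  have SV: "?S \<subset> V" "card (V - ?S) = card V - card ?S" and fin: "finite ?S"
    using inc finite_V by (auto simp: informed_def intro!: card_Diff_subset)
  have crossing: "\<alpha> * min (real (card ?S)) (real (card V - card ?S)) \<le> card C"
  proof (cases "2 * card ?S \<le> card V")
    case True
    have "boundary V E ?S \<subseteq> C" by (auto simp: boundary_def C_def informed_def)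
    then have "card (boundary V E ?S) \<le> card C"
      using finite_V by (intro card_mono) (auto simp: C_def)
    then show ?thesis
      using alpha(2)[OF SV(1) card_informed_bounds(1)[OF t(1)]] True by (simp add: min_def of_nat_diff)
  next
    case False
    have "boundary V E (V - ?S) \<subseteq> C" by (auto simp: boundary_def C_def informed_def)
    then have "card (boundary V E (V - ?S)) \<le> card C"
      using finite_V by (intro card_mono) (auto simp: C_def)
    moreover have "V - ?S \<subset> V" using SV card_informed_bounds(1)[OF t(1)] fin
      by (auto simp: card_gt_0_iff)
    ultimately show ?thesis
      using alpha(2)[of "V - ?S"] SV(2) False inc by (simp add: min_def of_nat_diff)
  qed
  have "\<alpha> * min (real (card ?S)) (real (card V - card ?S)) / (8 * (real \<Delta>)\<^sup>2) \<le>
      card C * (1 / (8 * (real \<Delta>)\<^sup>2))"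
    using divide_right_mono[OF crossing, of "8 * (real \<Delta>)\<^sup>2"] by simp
  also have "\<dots> \<le> (\<Sum>w\<in>V. measure_pmf.prob choices (X w))"
  proof -
    have "1 / (8 * (real \<Delta>)\<^sup>2) \<le> measure_pmf.prob choices (X w)" if w: "w \<in> C" for w
    proof -
      obtain u where u: "w \<in> V" "(u, w) \<in> E" "(t \<in> st u) \<noteq> (t \<in> st w)"
        using w unfolding C_def by blast
      let ?Y = "{(sent, acc, out). acc w = Some u \<and> t \<in> fst (out w) \<and> t \<in> snd (out w)}"
      \<comment> \<open>The definition of \<open>passing\<close> unfolds only under the locale
        assumptions, which hold on the support; intersecting with the support leaves the probability
        unchanged.\<close>
      have "?Y \<inter> set_pmf choices \<subseteq> X w"
      proof clarify
        fix sent acc out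
        assume c: "(sent, acc, out) \<in> set_pmf choices"
          and "acc w = Some u" "t \<in> fst (out w)" "t \<in> snd (out w)"
        then show "(sent, acc, out) \<in> X w"
          using u round_outcome.passing_def[OF round_outcome_choices[OF c]] by (simp add: X_def)
      qed
      then have "measure_pmf.prob choices (?Y \<inter> set_pmf choices) \<le> measure_pmf.prob choices (X w)"
        by (intro measure_pmf.finite_measure_mono) auto
      then show ?thesis
        using prob_connection[OF t u(2,3)] by (simp add: measure_Int_set_pmf)
    qed
    then have "(\<Sum>w\<in>C. 1 / (8 * (real \<Delta>)\<^sup>2)) \<le> (\<Sum>w\<in>C. measure_pmf.prob choices (X w))"
      by (intro sum_mono) auto
    also have "\<dots> \<le> (\<Sum>w\<in>V. measure_pmf.prob choices (X w))"
      using finite_V by (intro sum_mono2) (auto simp: C_def)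
    finally show ?thesis by simp
  qed
  also have "\<dots> = measure_pmf.expectation choices (\<lambda>(sent, acc, out). real (card (passes acc out t)))"
  proof -
    have "measure_pmf.expectation choices (\<lambda>(sent, acc, out). real (card (passes acc out t))) =
        measure_pmf.expectation choices (\<lambda>c. \<Sum>w\<in>V. indicator (X w) c)"
    proof (intro integral_cong_AE AE_pmfI)
      fix c assume c: "c \<in> set_pmf choices"
      obtain sent acc out where [simp]: "c = (sent, acc, out)" by (cases c)
      interpret round_outcome V E st sent acc out
        using round_outcome_choices c by simp
      have "passes acc out t \<subseteq> V" by (auto simp: passing_def)
      then show "(case c of (sent, acc, out) \<Rightarrow> real (card (passes acc out t))) =
          (\<Sum>w\<in>V. indicator (X w) c)"
        using finite_V by (simp add: X_def indicator_def sum.If_cases Int_absorb1)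
    qed auto
    also have "\<dots> = (\<Sum>w\<in>V. measure_pmf.expectation choices (indicator (X w)))"
      by (intro Bochner_Integration.integral_sum) (simp add: less_top[symmetric])
    finally show ?thesis by simp
  qed
  finally show ?thesis .
qed


text \<open>Sums the certain decrease over all tokens and keeps only the gain of \<open>t0\<close>,
  the other gains being nonnegative.\<close>

lemma potential_split:
  assumes "t0 \<in> A" "(sent, acc, out) \<in> set_pmf choices"
  shows "potential V A (new_state st sent acc out) +
      weight V A t0 * (real (card V) / (2 * (real (card (informed V st t0)))\<^sup>2)) * real (card (passes acc out t0))
    \<le> potential V A st"
proof -
  let ?st' = "new_state st sent acc out"
  let ?g = "\<lambda>t. real (card V) / (2 * (real (card (informed V st t)))\<^sup>2) * real (card (passes acc out t))"
  have "weight V A t0 * ?g t0 \<le> (\<Sum>t\<in>A. weight V A t * ?g t)"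
    using assms(1) finite_A
    by (intro member_le_sum[where f = "\<lambda>t. weight V A t * ?g t"]) (auto simp: weight_def)
  moreover have "(\<Sum>t\<in>A. weight V A t * deficit V ?st' t) + (\<Sum>t\<in>A. weight V A t * ?g t) \<le>
      (\<Sum>t\<in>A. weight V A t * deficit V st t)"
    unfolding sum.distrib[symmetric] distrib_left[symmetric]
    using deficit_step assms(2) by (intro sum_mono mult_left_mono) (auto simp: weight_def)
  ultimately show ?thesis by (simp add: potential_def mult.assoc)
qed

text \<open>The weights grow so fast that the smallest incomplete token, on which progress is made,
  carries at least half of the potential.\<close>
lemma potential_dominated:
  assumes t0: "t0 \<in> A" "\<And>t. t \<in> A \<Longrightarrow> t < t0 \<Longrightarrow> \<forall>u\<in>V. t \<in> st u"
    and inc: "card (informed V st t0) < card V"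
  shows "potential V A st \<le> 2 * (weight V A t0 * deficit V st t0)"
proof -
  define n where "n = real (card V)"
  define R where "R = {t \<in> A. t0 < t}"
  have n: "n \<ge> 2" using V by (simp add: n_def)
  have fR: "finite R" "t0 \<notin> R" using finite_A by (auto simp: R_def)
  have zero: "deficit V st t = 0" if "t \<in> A" "t < t0" for t
  proof -
    have "informed V st t = V" using t0(2)[OF that] by (auto simp: informed_def)
    then show ?thesis by (simp add: deficit_def)
  qed
  have "potential V A st = (\<Sum>t\<in>insert t0 R. weight V A t * deficit V st t)"
    unfolding potential_def using t0(1) zero finite_A
    by (intro sum.mono_neutral_right) (auto simp: R_def dest: linorder_neqE_nat)
  also have "\<dots> = weight V A t0 * deficit V st t0 + (\<Sum>t\<in>R. weight V A t * deficit V st t)"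
    using fR by simp
  \<comment> \<open>A token with a holder has deficit at most n - 1. All tokens above an element of
    \<open>R\<close> lie in \<open>R\<close> again, so the weights can be computed inside
    \<open>R\<close>.\<close>
  also have "(\<Sum>t\<in>R. weight V A t * deficit V st t) \<le> (\<Sum>t\<in>R. (n\<^sup>2) ^ card {t' \<in> R. t < t'} * (n - 1))"
  proof (rule sum_mono)
    fix t assume t: "t \<in> R"
    then have eq: "{t' \<in> A. t < t'} = {t' \<in> R. t < t'}" by (auto simp: R_def)
    have le: "deficit V st t \<le> n - 1"
      using card_informed_bounds[of t] t n
      by (simp add: deficit_def R_def n_def of_nat_diff field_simps)
    show "weight V A t * deficit V st t \<le> (n\<^sup>2) ^ card {t' \<in> R. t < t'} * (n - 1)"
      unfolding weight_def eq n_def[symmetric] by (rule mult_left_mono[OF le]) simp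
  qed
  also have "\<dots> = (\<Sum>t\<in>R. (n\<^sup>2) ^ card {t' \<in> R. t < t'}) * (n - 1)"
    by (simp add: sum_distrib_right)
  also have "\<dots> = ((n\<^sup>2) ^ card R - 1) / (n + 1)"
  proof -
    \<comment> \<open>The bound n - 1 on the deficits cancels against a factor of the n^2 - 1 in the
      geometric series.\<close>
    have "n\<^sup>2 - 1 = (n + 1) * (n - 1)" by (simp add: power2_eq_square algebra_simps)
    then show ?thesis
      using sum_geometric_rank[OF fR(1), of "n\<^sup>2"] n by (simp add: field_simps)
  qed
  also have "\<dots> \<le> (n\<^sup>2) ^ card R * (1 / (n + 1))"
    using n by (simp add: divide_right_mono)
  also have "\<dots> \<le> weight V A t0 * deficit V st t0"
  proof -
    have le: "1 / (n + 1) \<le> deficit V st t0"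
      unfolding deficit_def using card_informed_bounds(1)[OF t0(1)] inc
      by (intro frac_le) (auto simp: n_def)
    show ?thesis
      unfolding weight_def R_def n_def[symmetric] by (rule mult_left_mono[OF le]) simp
  qed
  finally show ?thesis by (simp only: mult_2)
qed

lemma potential_nonneg: "0 \<le> potential V A st1"
  by (auto simp: potential_def weight_def deficit_def intro!: sum_nonneg)

text \<open>The constant 32 is 8 * 2 * 2: from the probability of a passing connection, from the
  possible doubling of the informed set, and from the share of the smallest incomplete token in the
  potential.\<close>

lemma expected_potential:
  "(\<integral>\<^sup>+st1. ennreal (potential V A st1) \<partial>mtm_round V E blind_match_proposal I st) \<le>
    ennreal ((1 - \<alpha> / (32 * (real \<Delta>)\<^sup>2)) * potential V A st)"
proof (cases "\<exists>t\<in>A. card (informed V st t) < card V")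
  case False
  \<comment> \<open>If every token is complete, the new potential is at most 0 and the integral
    vanishes.\<close>
  then have zero: "deficit V st t = 0" if "t \<in> A" for t
    using that by (auto simp: deficit_def)
  have "potential V A (new_state st sent acc out) \<le> 0"
    if "(sent, acc, out) \<in> set_pmf choices" for sent acc out
  proof -
    have "deficit V (new_state st sent acc out) t \<le> 0" if "t \<in> A" for t
      using deficit_step[OF that \<open>_ \<in> set_pmf choices\<close>] zero[OF that]
      by (smt (verit) divide_nonneg_nonneg mult_nonneg_nonneg of_nat_0_le_iff zero_le_power2)
    then show ?thesis
      unfolding potential_def by (intro sum_nonpos mult_nonneg_nonpos) (auto simp: weight_def)
  qed
  then have "(\<integral>\<^sup>+st1. ennreal (potential V A st1) \<partial>mtm_round V E blind_match_proposal I st) =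
      (\<integral>\<^sup>+c. 0 \<partial>choices)"
    unfolding mtm_round_conv_choices nn_integral_map_pmf
    by (intro nn_integral_cong_AE AE_pmfI) (auto simp: ennreal_eq_0_iff)
  then show ?thesis by simp
next
  case True
  define t0 where "t0 = (LEAST t. t \<in> A \<and> card (informed V st t) < card V)"
  have t0: "t0 \<in> A" "card (informed V st t0) < card V"
    using LeastI_ex[of "\<lambda>t. t \<in> A \<and> card (informed V st t) < card V"] True
    by (auto simp: t0_def)
  have smaller: "\<forall>u\<in>V. t \<in> st u" if "t \<in> A" "t < t0" for t
  proof -
    have "\<not> card (informed V st t) < card V"
      using not_less_Least[of t "\<lambda>t. t \<in> A \<and> card (informed V st t) < card V"] that
      by (auto simp: t0_def)
    moreover have "informed V st t \<subseteq> V" by (auto simp: informed_def)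
    ultimately have "informed V st t = V"
      using finite_V psubset_card_mono by blast
    then show ?thesis by (auto simp: informed_def)
  qed
  define n where "n = real (card V)"
  define s where "s = real (card (informed V st t0))"
  define w where "w = weight V A t0"
  let ?new = "\<lambda>(sent, acc, out). potential V A (new_state st sent acc out)"
  let ?gain = "\<lambda>(sent :: nat \<Rightarrow> nat option, acc, out). real (card (passes acc out t0))"
  have s: "0 < s" "s < n" and w: "0 \<le> w"
    using card_informed_bounds[OF t0(1)] t0(2) by (auto simp: s_def n_def w_def weight_def)
  have split: "?new c + w * (n / (2 * s\<^sup>2)) * ?gain c \<le> potential V A st" if "c \<in> set_pmf choices" for c
    using potential_split[OF t0(1)] that by (cases c) (simp add: n_def s_def w_def)
  have coef: "0 \<le> w * (n / (2 * s\<^sup>2))" using s w by simp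
  have new_le: "?new c \<le> potential V A st" if "c \<in> set_pmf choices" for c
  proof -
    have "0 \<le> w * (n / (2 * s\<^sup>2)) * ?gain c"
      by (rule mult_nonneg_nonneg[OF coef]) (simp split: prod.splits)
    then show ?thesis using split[OF that] by linarith
  qed
  have int_new: "integrable choices ?new"
    using new_le potential_nonneg
    by (intro measure_pmf.integrable_const_bound[where B = "potential V A st"] AE_pmfI) auto
  have int_gain: "integrable choices ?gain"
  proof (intro measure_pmf.integrable_const_bound[where B = n] AE_pmfI)
    fix c assume c: "c \<in> set_pmf choices"
    obtain sent acc out where [simp]: "c = (sent, acc, out)" by (cases c)
    interpret round_outcome V E st sent acc out
      using round_outcome_choices c by simp
    have "card (passes acc out t0) \<le> card V"
      using finite_V by (intro card_mono) (auto simp: passing_def)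
    then show "norm (?gain c) \<le> n" by (simp add: n_def)
  qed auto
  have "measure_pmf.expectation choices ?new +
      w * (n / (2 * s\<^sup>2)) * measure_pmf.expectation choices ?gain
      = measure_pmf.expectation choices (\<lambda>c. ?new c + w * (n / (2 * s\<^sup>2)) * ?gain c)"
    using int_new int_gain by simp
  also have "\<dots> \<le> measure_pmf.expectation choices (\<lambda>_. potential V A st)"
    using int_new int_gain split by (intro integral_mono_AE AE_pmfI) auto
  finally have "measure_pmf.expectation choices ?new \<le>
      potential V A st - w * (n / (2 * s\<^sup>2)) * measure_pmf.expectation choices ?gain"
    by simp
  also have "\<dots> \<le> potential V A st - w * (n / (2 * s\<^sup>2)) * (\<alpha> * min s (n - s) / (8 * (real \<Delta>)\<^sup>2))"
    using expectation_card_passing[OF t0(1) smaller t0(2)] t0(2) coef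
    by (intro diff_left_mono mult_left_mono) (auto simp: s_def n_def of_nat_diff)
  also have "\<dots> \<le> potential V A st - w * ((n - s) / s) * (\<alpha> / (16 * (real \<Delta>)\<^sup>2))"
  proof -
    \<comment> \<open>The product is the larger times the smaller factor, and the larger is at most
      n. This turns the gain of order n min(s, n - s) / s^2 back into a multiple of the deficit (n -
      s) / s.\<close>
    have "s * (n - s) \<le> n * min s (n - s)"
      using mult_left_mono[of "n - s" n s] mult_right_mono[of s n "n - s"] s
      by (simp add: min_def mult.commute)
    then have "(s * (n - s)) * (w * \<alpha> / (16 * (s * \<Delta>)\<^sup>2)) \<le>
        (n * min s (n - s)) * (w * \<alpha> / (16 * (s * \<Delta>)\<^sup>2))"
      using w alpha(1) by (intro mult_right_mono) auto
    then show ?thesis using s by (simp add: power2_eq_square mult_ac)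
  qed
  also have "(n - s) / s = deficit V st t0"
    using t0(2) by (simp add: deficit_def n_def s_def of_nat_diff)
  also have "potential V A st - w * deficit V st t0 * (\<alpha> / (16 * (real \<Delta>)\<^sup>2)) \<le>
      potential V A st - potential V A st / 2 * (\<alpha> / (16 * (real \<Delta>)\<^sup>2))"
    using potential_dominated[OF t0(1) smaller t0(2)] alpha(1)
    by (intro diff_left_mono mult_right_mono) (auto simp: w_def)
  also have "\<dots> = (1 - \<alpha> / (32 * (real \<Delta>)\<^sup>2)) * potential V A st"
    by (simp add: algebra_simps)
  finally have E: "measure_pmf.expectation choices ?new \<le> \<dots>" .
  have "(\<integral>\<^sup>+st1. ennreal (potential V A st1) \<partial>mtm_round V E blind_match_proposal I st) =
      (\<integral>\<^sup>+c. ennreal (?new c) \<partial>choices)"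
    by (simp add: mtm_round_conv_choices case_prod_beta)
  also have "\<dots> = ennreal (measure_pmf.expectation choices ?new)"
    using int_new potential_nonneg by (intro nn_integral_eq_integral AE_pmfI) auto
  finally show ?thesis using E by (simp add: ennreal_leI)
qed

text \<open>Re-establishes the invariants of the locale for the next round.\<close>

lemma round_preserves_tokens:
  assumes "st1 \<in> set_pmf (mtm_round V E blind_match_proposal I st)"
  shows "u \<in> V \<Longrightarrow> st1 u \<subseteq> A" "t \<in> A \<Longrightarrow> \<exists>u\<in>V. t \<in> st1 u"
proof -
  obtain sent acc out where c: "(sent, acc, out) \<in> set_pmf choices"
    and st1: "st1 = new_state st sent acc out"
    using assms by (auto simp: mtm_round_conv_choices)
  interpret round_outcome V E st sent acc out using round_outcome_choices[OF c] .
  show "u \<in> V \<Longrightarrow> st1 u \<subseteq> A" using new_state_subset st_subset st1 by metis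
  show "t \<in> A \<Longrightarrow> \<exists>u\<in>V. t \<in> st1 u" using held new_state_mono st1 by blast
qed

end

section \<open>Iteration over rounds and Markov's inequality\<close>

text \<open>Invariant and bound are proved in one induction, as the contraction is available only at
  configurations satisfying the invariant. Each factor 1 - q is replaced by exp (- q), and
  nonnegative integrals pass through \<open>bind_pmf\<close> without integrability
  conditions.\<close>

lemma expected_potential_run:
  assumes round: "\<And>r st. 1 \<le> r \<Longrightarrow> \<forall>u\<in>V. st u \<subseteq> A \<Longrightarrow> \<forall>t\<in>A. \<exists>u\<in>V. t \<in> st u \<Longrightarrow>
      blind_match_round V (G r) N B \<epsilon> I A st \<alpha> \<Delta>"
    and T: "\<forall>u\<in>V. T u \<subseteq> A" "\<forall>t\<in>A. \<exists>u\<in>V. t \<in> T u"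
  shows "\<forall>st\<in>set_pmf (blind_match V G I T f). (\<forall>u\<in>V. st u \<subseteq> A) \<and> (\<forall>t\<in>A. \<exists>u\<in>V. t \<in> st u)"
      (is "\<forall>st\<in>_. ?valid st")
    and "(\<integral>\<^sup>+st. ennreal (potential V A st) \<partial>blind_match V G I T f) \<le>
      ennreal (exp (- (\<alpha> / (32 * (real \<Delta>)\<^sup>2)) * real f) * potential V A T)"
proof (induction f)
  case 0
  case 1
  show ?case using T by (simp add: blind_match_def)
  case 2
  show ?case by (simp add: blind_match_def)
next
  case (Suc f)
  define q where "q = \<alpha> / (32 * (real \<Delta>)\<^sup>2)"
  let ?M = "blind_match V G I T f"
  let ?R = "mtm_round V (G (Suc f)) blind_match_proposal I"
  have run: "blind_match V G I T (Suc f) = bind_pmf ?M ?R"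
    by (simp add: blind_match_def)
  have rnd: "blind_match_round V (G (Suc f)) N B \<epsilon> I A st \<alpha> \<Delta>" if "st \<in> set_pmf ?M" for st
    using round[of "Suc f" st] Suc(1) that by simp
  case 1
  show ?case
    using blind_match_round.round_preserves_tokens[OF rnd] unfolding run by (simp; blast)
  case 2
  have step: "(\<integral>\<^sup>+st1. ennreal (potential V A st1) \<partial>?R st) \<le>
      ennreal (exp (- q)) * ennreal (potential V A st)" if "st \<in> set_pmf ?M" for st
  proof -
    interpret blind_match_round V "G (Suc f)" N B \<epsilon> I A st \<alpha> \<Delta> using rnd[OF that] .
    have "(1 - q) * potential V A st \<le> exp (- q) * potential V A st"
      using exp_ge_add_one_self[of "- q"] potential_nonneg by (intro mult_right_mono) auto
    then show ?thesis
      using expected_potential potential_nonneg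
      by (simp add: q_def order_trans ennreal_leI flip: ennreal_mult)
  qed
  have "(\<integral>\<^sup>+st. ennreal (potential V A st) \<partial>blind_match V G I T (Suc f)) \<le>
      (\<integral>\<^sup>+st. ennreal (exp (- q)) * ennreal (potential V A st) \<partial>?M)"
    unfolding run nn_integral_bind_pmf using step by (intro nn_integral_mono_AE AE_pmfI)
  also have "\<dots> = ennreal (exp (- q)) * (\<integral>\<^sup>+st. ennreal (potential V A st) \<partial>?M)"
    by (simp add: nn_integral_cmult)
  also have "\<dots> \<le> ennreal (exp (- q)) * ennreal (exp (- q * real f) * potential V A T)"
    using Suc(2) by (intro mult_left_mono) (simp_all add: q_def)
  also have "\<dots> = ennreal (exp (- q * real (Suc f)) * potential V A T)"
  proof -
    have "exp (- q * real (Suc f)) = exp (- q) * exp (- q * real f)"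
      by (subst exp_add[symmetric]) (simp add: algebra_simps)
    then show ?thesis by (simp only: ennreal_mult'[OF exp_ge_zero] mult.assoc)
  qed
  finally show ?case by (simp add: q_def)
qed

text \<open>Every token has a holder, so deficits are at most n; the weights form a geometric series
  of ratio n^2 \<ge> 4, with sum at most n^(2 |A|).\<close>

lemma potential_le:
  assumes "finite A" "1 < card V" "\<And>t. t \<in> A \<Longrightarrow> \<exists>u\<in>V. t \<in> st u"
  shows "potential V A st \<le> real (card V) ^ (2 * card A + 1)"
proof -
  define n where "n = real (card V)"
  have n: "2 \<le> n" and fin: "finite V" using assms(2) card_ge_0_finite[of V] by (auto simp: n_def)
  have "potential V A st \<le> (\<Sum>t\<in>A. (n\<^sup>2) ^ card {t' \<in> A. t < t'} * n)"
    unfolding potential_def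
  proof (rule sum_mono)
    fix t assume "t \<in> A"
    then have "informed V st t \<noteq> {}" using assms(3) by (auto simp: informed_def)
    then have "1 \<le> real (card (informed V st t))"
      using fin by (simp add: Suc_le_eq card_gt_0_iff informed_def)
    then have "deficit V st t \<le> n / 1"
      unfolding deficit_def n_def by (intro frac_le) auto
    then show "weight V A t * deficit V st t \<le> (n\<^sup>2) ^ card {t' \<in> A. t < t'} * n"
      by (auto simp: weight_def n_def intro: mult_left_mono)
  qed
  also have "\<dots> = (\<Sum>t\<in>A. (n\<^sup>2) ^ card {t' \<in> A. t < t'}) * n"
    by (simp add: sum_distrib_right)
  also have "\<dots> \<le> (n\<^sup>2) ^ card A * n"
  proof (rule mult_right_mono)
    have "2\<^sup>2 \<le> n\<^sup>2" using n by (intro power_mono) auto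
    then have "1 * (\<Sum>t\<in>A. (n\<^sup>2) ^ card {t' \<in> A. t < t'}) \<le>
        (n\<^sup>2 - 1) * (\<Sum>t\<in>A. (n\<^sup>2) ^ card {t' \<in> A. t < t'})"
      by (intro mult_right_mono sum_nonneg) auto
    also have "\<dots> \<le> (n\<^sup>2) ^ card A"
      by (simp add: sum_geometric_rank[OF assms(1)])
    finally show "(\<Sum>t\<in>A. (n\<^sup>2) ^ card {t' \<in> A. t < t'}) \<le> (n\<^sup>2) ^ card A" by simp
  qed (use n in simp)
  finally show ?thesis by (simp only: n_def power_add power_mult power_one_right)
qed

text \<open>The threshold for Markov's inequality: an incomplete token has weight at least 1 and
  deficit at least 1 / n.\<close>

lemma potential_ge_unless_complete:
  assumes "finite V" "1 < card V" "finite A" "t \<in> A" "\<exists>u\<in>V. t \<in> st u" "\<exists>u\<in>V. t \<notin> st u"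
  shows "1 \<le> real (card V) * potential V A st"
proof -
  let ?S = "informed V st t"
  have "?S \<noteq> {}" "?S \<subset> V" using assms(5,6) by (auto simp: informed_def)
  moreover have "finite ?S" using assms(1) by (simp add: informed_def)
  ultimately have S: "0 < card ?S" "card ?S < card V"
    using psubset_card_mono[OF assms(1)] by (auto simp: card_gt_0_iff)
  have d: "1 / real (card V) \<le> deficit V st t"
    unfolding deficit_def using S by (intro frac_le) auto
  have "1 * deficit V st t \<le> weight V A t * deficit V st t"
    using assms(2) by (intro mult_right_mono) (auto simp: weight_def deficit_def intro: one_le_power)
  also have "\<dots> \<le> potential V A st"
    unfolding potential_def using assms(3,4)
    by (intro member_le_sum[where f = "\<lambda>t. weight V A t * deficit V st t"])
       (auto simp: weight_def deficit_def)
  finally have "1 / real (card V) \<le> potential V A st" using d by simp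
  then show ?thesis using S by (simp add: field_simps)
qed

text \<open>The exponent 2 |A| + 3 is what Markov's inequality requires: the initial potential costs
  2 |A| + 1, the threshold 1 / n costs 1, and one more factor n leaves failure probability 1 /
  n.\<close>

lemma solves_gossip_in_exp_bound:
  assumes round: "\<And>r st. 1 \<le> r \<Longrightarrow> \<forall>u\<in>V. st u \<subseteq> A \<Longrightarrow> \<forall>t\<in>A. \<exists>u\<in>V. t \<in> st u \<Longrightarrow>
      blind_match_round V (G r) N B \<epsilon> I A st \<alpha> \<Delta>"
    and A: "A = (\<Union>u\<in>V. T u)" "finite A" and V: "finite V" "1 < card V"
    and f: "(2 * real (card A) + 3) * ln (real (card V)) \<le> \<alpha> / (32 * (real \<Delta>)\<^sup>2) * real f"
  shows "solves_gossip_in V T (blind_match V G I T) f"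
proof -
  define n where "n = real (card V)"
  define m where "m = 2 * card A"
  define q where "q = \<alpha> / (32 * (real \<Delta>)\<^sup>2)"
  let ?M = "blind_match V G I T f"
  let ?done = "{T'. \<forall>u\<in>V. (\<Union>v\<in>V. T v) \<subseteq> T' u}"
  have n: "1 < n" using V by (simp add: n_def)
  have T: "\<forall>u\<in>V. T u \<subseteq> A" "\<forall>t\<in>A. \<exists>u\<in>V. t \<in> T u" using A by auto
  note run = expected_potential_run[where G = G, OF round T]
  have "exp (- q * real f) \<le> exp (- (real (m + 3) * ln n))"
    using f by (simp add: q_def n_def m_def)
  also have "\<dots> = 1 / n ^ (m + 3)"
    using n by (simp only: exp_minus exp_of_nat_mult exp_ln inverse_eq_divide)
  finally have decay: "exp (- q * real f) \<le> 1 / n ^ (m + 3)" .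
  have "n * (exp (- q * real f) * potential V A T) \<le> n * (1 / n ^ (m + 3) * n ^ (m + 1))"
    using decay n potential_le[OF A(2) V(2), of T] T
    by (intro mult_left_mono mult_mono)
       (auto simp: n_def m_def potential_def weight_def deficit_def intro!: sum_nonneg)
  also have "\<dots> = 1 / n"
    using n by (simp add: field_simps power_add eval_nat_numeral)
  finally have small: "n * (exp (- q * real f) * potential V A T) \<le> 1 / n" .
  \<comment> \<open>Markov's inequality: n times the potential dominates the indicator of failure on
    the support.\<close>
  have "emeasure ?M (- ?done) = (\<integral>\<^sup>+st. indicator (- ?done) st \<partial>?M)"
    by simp
  also have "\<dots> \<le> (\<integral>\<^sup>+st. ennreal n * ennreal (potential V A st) \<partial>?M)"
  proof (intro nn_integral_mono_AE AE_pmfI)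
    fix st assume st: "st \<in> set_pmf ?M"
    show "indicator (- ?done) st \<le> ennreal n * ennreal (potential V A st)"
    proof (cases "st \<in> ?done")
      case False
      then obtain u t where "u \<in> V" "t \<in> A" "t \<notin> st u" using A(1) by auto
      moreover have "\<forall>t\<in>A. \<exists>u\<in>V. t \<in> st u" using run(1) st by blast
      ultimately have "1 \<le> n * potential V A st"
        unfolding n_def using potential_ge_unless_complete[OF V A(2)] by blast
      then have "ennreal 1 \<le> ennreal n * ennreal (potential V A st)"
        using n by (subst ennreal_mult'[symmetric]) (auto intro: ennreal_leI)
      then show ?thesis using False by simp
    qed simp
  qed
  also have "\<dots> = ennreal n * (\<integral>\<^sup>+st. ennreal (potential V A st) \<partial>?M)"
    by (simp add: nn_integral_cmult)
  also have "\<dots> \<le> ennreal n * ennreal (exp (- q * real f) * potential V A T)"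
    unfolding q_def by (rule mult_left_mono[OF run(2) zero_le])
  also have "\<dots> \<le> ennreal (1 / n)"
    unfolding ennreal_mult'[symmetric, OF less_imp_le[OF order.strict_trans[OF zero_less_one n]]]
    by (rule ennreal_leI[OF small])
  finally have "measure_pmf.prob ?M (- ?done) \<le> 1 / n"
    using n unfolding measure_pmf.emeasure_eq_measure by (subst (asm) ennreal_le_iff) simp_all
  moreover have "measure_pmf.prob ?M (- ?done) = 1 - measure_pmf.prob ?M ?done"
    using measure_pmf.prob_compl[of ?done ?M] by (simp add: Compl_eq_Diff_UNIV)
  ultimately show ?thesis by (simp add: solves_gossip_in_def n_def)
qed

section \<open>Expansion and degree of connected dynamic graphs\<close>

text \<open>A set with empty boundary is closed under edges, hence under reachability, so
  connectedness would make it all of \<open>V\<close>.\<close>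

lemma boundary_nonempty:
  assumes "connected_graph V E" "S \<subset> V" "S \<noteq> {}"
  shows "boundary V E S \<noteq> {}"
proof
  assume "boundary V E S = {}"
  then have "E `` S \<subseteq> S"
    using assms(1) by (auto simp: boundary_def connected_graph_def)
  then have "E\<^sup>* `` S = S" by (rule Image_closed_trancl)
  moreover obtain u v where uv: "u \<in> S" "v \<in> V - S" using assms(2,3) by blast
  then have "(u, v) \<in> E\<^sup>*" using assms(1,2) by (auto simp: connected_graph_def)
  ultimately show False using uv by blast
qed

lemma neighbours_nonempty:
  assumes "connected_graph V E" "1 < card V" "u \<in> V"
  shows "neighbours E u \<noteq> {}"
proof -
  have "{u} \<noteq> V" using assms(2) by auto
  then show ?thesis
    using boundary_nonempty[OF assms(1), of "{u}"] assms(3)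
    by (auto simp: boundary_def neighbours_def)
qed

lemma vertex_expansion_properties:
  assumes "connected_graph V E" "finite V" "1 < card V"
  shows "0 < vertex_expansion V E"
    and "S \<subset> V \<Longrightarrow> 0 < card S \<Longrightarrow> real (card S) \<le> real (card V) / 2 \<Longrightarrow>
      vertex_expansion V E * real (card S) \<le> real (card (boundary V E S))"
proof -
  let ?F = "{S. S \<subset> V \<and> 0 < card S \<and> real (card S) \<le> real (card V) / 2}"
  let ?r = "\<lambda>S. real (card (boundary V E S)) / real (card S)"
  have fin: "finite (?r ` ?F)"
    by (rule finite_imageI, rule finite_subset[of _ "Pow V"]) (use assms(2) in auto)
  \<comment> \<open>A singleton is admissible because n \<ge> 2, so the minimum is over a nonempty
    set.\<close>
  obtain u where "u \<in> V" using assms(3) by fastforce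
  then have "{u} \<in> ?F" using assms(3) by auto
  then have ne: "?r ` ?F \<noteq> {}" by blast
  have "0 < ?r S" if "S \<in> ?F" for S
  proof -
    have "S \<noteq> {}" "S \<subset> V" using that by auto
    then have "boundary V E S \<noteq> {}" using boundary_nonempty[OF assms(1)] by blast
    moreover have "finite (boundary V E S)" using assms(2) by (simp add: boundary_def)
    ultimately show ?thesis using that by (simp add: card_gt_0_iff)
  qed
  then show "0 < vertex_expansion V E"
    unfolding vertex_expansion_def Min_gr_iff[OF fin ne] by blast
  show "vertex_expansion V E * real (card S) \<le> real (card (boundary V E S))"
    if "S \<subset> V" "0 < card S" "real (card S) \<le> real (card V) / 2"
  proof -
    have "vertex_expansion V E \<le> ?r S"
      unfolding vertex_expansion_def using fin that by (intro Min_le) auto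
    then show ?thesis using that(2) by (simp add: field_simps)
  qed
qed

text \<open>All graphs are subsets of \<open>V \<times> V\<close>, so the minimum over infinitely
  many rounds is over finitely many values and is attained in some round; this gives
  positivity.\<close>

lemma expansion_properties:
  assumes "dynamic_graph V G" "1 < card V"
  shows "0 < expansion V G" and "1 \<le> r \<Longrightarrow> expansion V G \<le> vertex_expansion V (G r)"
proof -
  have "(\<lambda>r. vertex_expansion V (G r)) ` {1..} \<subseteq> vertex_expansion V ` Pow (V \<times> V)"
    using assms(1) by (auto simp: dynamic_graph_def connected_graph_def)
  then have fin: "finite ((\<lambda>r. vertex_expansion V (G r)) ` {1..})"
    by (rule finite_subset) (use assms(1) in \<open>simp add: dynamic_graph_def\<close>)
  have "expansion V G \<in> (\<lambda>r. vertex_expansion V (G r)) ` {1..}"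
    unfolding expansion_def by (intro Min_in fin) auto
  then show "0 < expansion V G"
    using vertex_expansion_properties(1) assms by (auto simp: dynamic_graph_def)
  show "1 \<le> r \<Longrightarrow> expansion V G \<le> vertex_expansion V (G r)"
    unfolding expansion_def by (intro Min_le fin) auto
qed

lemma degree_le_max_degree:
  assumes "dynamic_graph V G" "1 \<le> r" "u \<in> V"
  shows "card (neighbours (G r) u) \<le> max_degree V G"
proof -
  have fin: "finite V" using assms(1) by (simp add: dynamic_graph_def)
  have "(\<lambda>(r, u). card (neighbours (G r) u)) ` ({1..} \<times> V) \<subseteq> {..card V}"
  proof clarsimp
    fix r u assume "Suc 0 \<le> r" "u \<in> V"
    then have "neighbours (G r) u \<subseteq> V"
      using assms(1) by (auto simp: dynamic_graph_def connected_graph_def neighbours_def)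
    then show "card (neighbours (G r) u) \<le> card V" using card_mono[OF fin] by blast
  qed
  then have "finite ((\<lambda>(r, u). card (neighbours (G r) u)) ` ({1..} \<times> V))"
    by (rule finite_subset) simp
  then show ?thesis
    unfolding max_degree_def using assms(2,3) by (intro Max_ge) force+
qed

text \<open>Seen on a singleton. It yields \<Delta> \<ge> 1 and \<Delta>^2 / \<alpha> \<ge> 1, which
  lets the rounding of the round count be absorbed into the bound.\<close>

lemma expansion_le_max_degree:
  assumes "dynamic_graph V G" "1 < card V"
  shows "expansion V G \<le> real (max_degree V G)"
proof -
  obtain u where u: "u \<in> V" using assms(2) by fastforce
  have G: "connected_graph V (G 1)" "finite V" using assms(1) by (auto simp: dynamic_graph_def)
  have "boundary V (G 1) {u} \<subseteq> neighbours (G 1) u"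
    by (auto simp: boundary_def neighbours_def)
  moreover have "finite (neighbours (G 1) u)"
    by (rule finite_subset[of _ V]) (use G in \<open>auto simp: connected_graph_def neighbours_def\<close>)
  ultimately have "card (boundary V (G 1) {u}) \<le> card (neighbours (G 1) u)"
    by (rule card_mono[rotated])
  also have "\<dots> \<le> max_degree V G"
    by (rule degree_le_max_degree[OF assms(1) order_refl u])
  finally have "card (boundary V (G 1) {u}) \<le> max_degree V G" .
  moreover have "{u} \<subset> V" using u assms(2) by (metis card.empty card_insert_if finite.emptyI
      empty_iff insert_subset less_irrefl One_nat_def psubsetI empty_subsetI)
  ultimately show ?thesis
    using vertex_expansion_properties(2)[OF G assms(2), of "{u}"] assms(2)
      expansion_properties(2)[OF assms, of 1] by simp
qed

section \<open>The number of rounds and its constants\<close>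

lemma blind_match_rounds:
  assumes "dynamic_graph V G" "1 < card V" "V \<subseteq> {1..N}" "A \<subseteq> {1..N}"
    and "is_transfer N B \<epsilon> I" "\<epsilon> \<le> 1 / 2" "1 \<le> r"
    and "\<forall>u\<in>V. st u \<subseteq> A" "\<forall>t\<in>A. \<exists>u\<in>V. t \<in> st u"
  shows "blind_match_round V (G r) N B \<epsilon> I A st (expansion V G) (max_degree V G)"
proof -
  have G: "connected_graph V (G r)" "finite V"
    using assms(1,7) by (auto simp: dynamic_graph_def)
  show ?thesis
  proof
    show "expansion V G * real (card S) \<le> real (card (boundary V (G r) S))"
      if "S \<subset> V" "0 < card S" "real (card S) \<le> real (card V) / 2" for S
      using mult_right_mono[OF expansion_properties(2)[OF assms(1,2,7)], of "real (card S)"]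
        vertex_expansion_properties(2)[OF G assms(2) that] by simp
  qed (use assms G neighbours_nonempty degree_le_max_degree expansion_properties(1)
      in \<open>auto simp: connected_graph_def less_imp_le\<close>)
qed

text \<open>161 = 32 * 5 + 1: 32 from the contraction rate, 5 from 2 k + 3 \<le> 5 k for k \<ge> 1,
  and 1 from rounding up.\<close>

lemma blind_match_solves_gossip:
  assumes G: "dynamic_graph V G" and V: "1 < card V" and inst: "gossip_instance V N k T"
    and c: "1 \<le> c" and transfer: "is_transfer N B (real N powr (- c)) transfer"
  shows "\<exists>f::nat. real f \<le> 161 * ((1 / expansion V G) * real k *
      (real (max_degree V G))\<^sup>2 * (log 2 (real N))\<^sup>2) \<and>
      solves_gossip_in V T (blind_match V G transfer T) f"
proof -
  define A where "A = (\<Union>u\<in>V. T u)"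
  define \<alpha> where "\<alpha> = expansion V G"
  define \<Delta> where "\<Delta> = max_degree V G"
  define L where "L = log 2 (real N)"
  define f where "f = nat \<lceil>32 * (real \<Delta>)\<^sup>2 / \<alpha> * ((2 * real k + 3) * ln (real (card V)))\<rceil>"
  have VN: "V \<subseteq> {1..N}" and AN: "A \<subseteq> {1..N}" and k: "card A = k" "1 \<le> k"
    using inst by (auto simp: gossip_instance_def A_def)
  have fin: "finite V" "finite A" using VN AN finite_subset by blast+
  have N: "card V \<le> N" "2 \<le> N" using card_mono[OF _ VN] V by auto
  have \<alpha>: "0 < \<alpha>" "\<alpha> \<le> real \<Delta>"
    using expansion_properties(1)[OF G V] expansion_le_max_degree[OF G V] by (auto simp: \<alpha>_def \<Delta>_def)
  then have \<Delta>: "1 \<le> real \<Delta>" by (cases \<Delta>) auto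
  \<comment> \<open>Here c \<ge> 1 and N \<ge> 2 enter, giving Transfer a success probability of at
    least 1 / 2.\<close>
  have eps: "real N powr (- c) \<le> 1 / 2"
  proof -
    have "real N powr (- c) \<le> real N powr (- 1)" using c N by (intro powr_mono) auto
    also have "\<dots> \<le> 1 / 2" using N by (simp add: powr_minus_divide)
    finally show ?thesis .
  qed
  have solves: "solves_gossip_in V T (blind_match V G transfer T) f"
  proof (rule solves_gossip_in_exp_bound[OF _ A_def fin(2,1) V])
    show "blind_match_round V (G r) N B (real N powr (- c)) transfer A st \<alpha> \<Delta>"
      if "1 \<le> r" "\<forall>u\<in>V. st u \<subseteq> A" "\<forall>t\<in>A. \<exists>u\<in>V. t \<in> st u" for r st
      unfolding \<alpha>_def \<Delta>_def by (rule blind_match_rounds[OF G V VN AN transfer eps that])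
    have "32 * (real \<Delta>)\<^sup>2 / \<alpha> * ((2 * real k + 3) * ln (real (card V))) \<le> real f"
      unfolding f_def by linarith
    then have "\<alpha> / (32 * (real \<Delta>)\<^sup>2) * (32 * (real \<Delta>)\<^sup>2 / \<alpha> * ((2 * real k + 3) * ln (real (card V)))) \<le>
        \<alpha> / (32 * (real \<Delta>)\<^sup>2) * real f"
      using \<alpha> by (intro mult_left_mono) auto
    then show "(2 * real (card A) + 3) * ln (real (card V)) \<le> \<alpha> / (32 * (real \<Delta>)\<^sup>2) * real f"
      using \<alpha> \<Delta> k by simp
  qed
  have L: "1 \<le> L" using N by (simp add: L_def le_log_iff)
  have "ln (real (card V)) \<le> L"
  proof -
    have "ln (real (card V)) \<le> ln (real N)" using N V by simp
    also have "\<dots> \<le> ln (real N) / ln 2"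
      using N ln_2_less_1 by (simp add: field_simps mult_left_le)
    finally show ?thesis by (simp add: L_def log_def)
  qed
  also have "L \<le> L\<^sup>2" using L by (simp add: power2_eq_square)
  finally have lnL: "ln (real (card V)) \<le> L\<^sup>2" .
  define M where "M = (real \<Delta>)\<^sup>2 / \<alpha>"
  have M: "1 \<le> M"
  proof -
    have "\<alpha> \<le> (real \<Delta>)\<^sup>2"
      using \<alpha>(2) self_le_power[OF \<Delta>, of 2] by linarith
    then show ?thesis using \<alpha> by (simp add: M_def)
  qed
  have "0 \<le> 32 * M * ((2 * real k + 3) * ln (real (card V)))"
    using M V by (intro mult_nonneg_nonneg) auto
  then have "real f \<le> 32 * M * ((2 * real k + 3) * ln (real (card V))) + 1"
    unfolding f_def M_def times_divide_eq_right by linarith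
  also have "\<dots> \<le> 32 * M * ((5 * real k) * L\<^sup>2) + M * real k * L\<^sup>2"
  proof (rule add_mono)
    have "(2 * real k + 3) * ln (real (card V)) \<le> (5 * real k) * L\<^sup>2"
      using k V by (intro mult_mono lnL) auto
    then show "32 * M * ((2 * real k + 3) * ln (real (card V))) \<le> 32 * M * ((5 * real k) * L\<^sup>2)"
      using M by (intro mult_left_mono) auto
    \<comment> \<open>Absorbs the rounding error, each of the three factors being at least
      1.\<close>
    have "1 * 1 * 1 \<le> M * real k * L\<^sup>2"
      using M k L by (intro mult_mono) auto
    then show "1 \<le> M * real k * L\<^sup>2" by simp
  qed
  also have "\<dots> = 161 * ((1 / \<alpha>) * real k * (real \<Delta>)\<^sup>2 * L\<^sup>2)"
    by (simp add: M_def)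
  finally have "real f \<le> 161 * ((1 / \<alpha>) * real k * (real \<Delta>)\<^sup>2 * L\<^sup>2)" .
  then show ?thesis
    using solves unfolding \<alpha>_def \<Delta>_def L_def by blast
qed

theorem theorem4p1:
  fixes B :: nat
  shows "\<exists>c\<^sub>0>0::real. \<forall>c\<ge>c\<^sub>0. \<exists>C>0::real.
    \<forall>(V :: nat set) (N :: nat) (k :: nat) (G :: nat \<Rightarrow> graph) (\<tau> :: enat)
      (T :: nat \<Rightarrow> nat set) (transfer :: nat set interaction).
      dynamic_graph V G \<and> card V > 1 \<and> \<tau> \<ge> 1 \<and> stability_factor G \<tau> \<and>
      gossip_instance V N k T \<and> is_transfer N B (real N powr (- c)) transfer \<longrightarrow>
      (\<exists>f::nat.
         real f \<le> C * ((1 / expansion V G) * real k * (real (max_degree V G))\<^sup>2 * (log 2 (real N))\<^sup>2) \<and>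
         solves_gossip_in V T (blind_match V G transfer T) f)"
proof (rule exI[of _ "1::real"], intro conjI allI impI)
  \<comment> \<open>The threshold 1 for c makes Transfer fail with probability at most 1 / 2; the
    constant 161 is then the same for all c and all \<open>B\<close>.\<close>
  fix c :: real assume "1 \<le> c"
  then show "\<exists>C>0::real. \<forall>(V :: nat set) N k G (\<tau> :: enat) T transfer.
      dynamic_graph V G \<and> card V > 1 \<and> \<tau> \<ge> 1 \<and> stability_factor G \<tau> \<and>
      gossip_instance V N k T \<and> is_transfer N B (real N powr (- c)) transfer \<longrightarrow>
      (\<exists>f::nat.
         real f \<le> C * ((1 / expansion V G) * real k * (real (max_degree V G))\<^sup>2 * (log 2 (real N))\<^sup>2) \<and>
         solves_gossip_in V T (blind_match V G transfer T) f)"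
    by (intro exI[of _ "161::real"] conjI allI impI blind_match_solves_gossip; (elim conjE)?) simp_all
qed simp

end
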